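(* Let $X=\overline{K_4\,\square\,K_4}$ be the complement of the Cartesian product $K_4\,\square\,K_4$, and let $\Gamma=X\,\square\,X$, a graph on $256$ vertices with vertex-primitive automorphism group. Then $\Gamma$ has non-uniform endomorphisms of ranks $6$, $9$ and $12$: one of rank $6$ with four kernel classes of size $32$ and two of size $64$; one of rank $9$ with four kernel classes of size $16$, four of size $32$ and one of size $64$; and one of rank $12$ with eight kernel classes of size $16$ and four of size $32$. In particular the primitive group $\mathrm{Aut}(\Gamma)$ fails to synchronize a non-uniform map of rank $6$.
   Context: The Cartesian product $Y\,\square\,Z$ of graphs has vertex set $V(Y)\times V(Z)$, with $(y_1,z_1)$ and $(y_2,z_2)$ adjacent if and only if they are equal in one coordinate and adjacent in the other. An endomorphism of a graph is a map from the vertex set to itself sending edges to edges; its rank is the size of its image and its kernel classes are its non-empty fibres; it is non-uniform if the kernel classes do not all have the same size. A permutation group is primitive if it is transitive and preserves no equivalence relation other than equality and the universal relation. A group $G$ synchronizes a map $f$ if the transformation semigroup $\langle G,f\rangle$ contains a constant map. *)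

theory Defs
  imports "Graph_Theory.Pair_Digraph" "HOL-Algebra.Group_Action"
begin

text \<open>
  A simple graph is a \<^locale>\<open>pair_graph\<close>: a finite, symmetric, loopless digraph whose arcs are
  ordered pairs of vertices, so that every undirected edge contributes both of its orientations.

  Transformations and permutations of a set \<open>\<Omega>\<close> are extensional functions
  (as in \<^const>\<open>Bij\<close> and \<^const>\<open>BijGroup\<close>), composed by \<^term>\<open>compose \<Omega>\<close>; this
  makes two maps equal exactly when they agree on \<open>\<Omega>\<close>.
\<close>

definition complete_graph :: "nat \<Rightarrow> nat pair_pre_digraph" where
  "complete_graph n =
     \<lparr>pverts = {..<n}, parcs = {(u, v). u < n \<and> v < n \<and> u \<noteq> v}\<rparr>"

definition complement_graph :: "'a pair_pre_digraph \<Rightarrow> 'a pair_pre_digraph" where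
  "complement_graph G =
     \<lparr>pverts = pverts G,
      parcs = {(u, v). u \<in> pverts G \<and> v \<in> pverts G \<and> u \<noteq> v \<and> (u, v) \<notin> parcs G}\<rparr>"

definition cartesian_product ::
    "'a pair_pre_digraph \<Rightarrow> 'b pair_pre_digraph \<Rightarrow> ('a \<times> 'b) pair_pre_digraph"
    (infixr \<open>\<box>\<close> 80) where
  "Y \<box> Z =
     \<lparr>pverts = pverts Y \<times> pverts Z,
      parcs = {((y1, z1), (y2, z2)).
                 (y1, z1) \<in> pverts Y \<times> pverts Z \<and> (y2, z2) \<in> pverts Y \<times> pverts Z \<and>
                 (y1 = y2 \<and> (z1, z2) \<in> parcs Z \<or> z1 = z2 \<and> (y1, y2) \<in> parcs Y)}\<rparr>"

definition graph_endomorphisms :: "'a pair_pre_digraph \<Rightarrow> ('a \<Rightarrow> 'a) set" where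
  "graph_endomorphisms G =
     {f \<in> pverts G \<rightarrow>\<^sub>E pverts G. \<forall>(u, v) \<in> parcs G. (f u, f v) \<in> parcs G}"

definition graph_automorphisms :: "'a pair_pre_digraph \<Rightarrow> ('a \<Rightarrow> 'a) set" where
  "graph_automorphisms G =
     {g \<in> Bij (pverts G).
        \<forall>u \<in> pverts G. \<forall>v \<in> pverts G. (u, v) \<in> parcs G \<longleftrightarrow> (g u, g v) \<in> parcs G}"

definition map_rank :: "'a set \<Rightarrow> ('a \<Rightarrow> 'a) \<Rightarrow> nat" where
  "map_rank \<Omega> f = card (f ` \<Omega>)"

definition kernel_classes :: "'a set \<Rightarrow> ('a \<Rightarrow> 'a) \<Rightarrow> 'a set set" where
  "kernel_classes \<Omega> f = (\<lambda>y. {x \<in> \<Omega>. f x = y}) ` (f ` \<Omega>)"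

definition non_uniform :: "'a set \<Rightarrow> ('a \<Rightarrow> 'a) \<Rightarrow> bool" where
  "non_uniform \<Omega> f \<longleftrightarrow>
     \<not> (\<forall>A \<in> kernel_classes \<Omega> f. \<forall>B \<in> kernel_classes \<Omega> f. card A = card B)"

definition kernel_classes_of_size :: "'a set \<Rightarrow> ('a \<Rightarrow> 'a) \<Rightarrow> nat \<Rightarrow> 'a set set" where
  "kernel_classes_of_size \<Omega> f k = {A \<in> kernel_classes \<Omega> f. card A = k}"

inductive_set transformation_semigroup :: "'a set \<Rightarrow> ('a \<Rightarrow> 'a) set \<Rightarrow> ('a \<Rightarrow> 'a) set"
  for \<Omega> :: "'a set" and S :: "('a \<Rightarrow> 'a) set" where
  generator: "f \<in> S \<Longrightarrow> f \<in> transformation_semigroup \<Omega> S"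
| composition: "f \<in> transformation_semigroup \<Omega> S \<Longrightarrow> g \<in> transformation_semigroup \<Omega> S \<Longrightarrow>
    compose \<Omega> f g \<in> transformation_semigroup \<Omega> S"

definition primitive_group :: "'a set \<Rightarrow> ('a \<Rightarrow> 'a) set \<Rightarrow> bool" where
  "primitive_group \<Omega> G \<longleftrightarrow>
     subgroup G (BijGroup \<Omega>) \<and>
     transitive_action (BijGroup \<Omega>\<lparr>carrier := G\<rparr>) \<Omega> (\<lambda>g. g) \<and>
     (\<forall>R. equiv \<Omega> R \<and> (\<forall>g \<in> G. \<forall>(x, y) \<in> R. (g x, g y) \<in> R) \<longrightarrow> R = Id_on \<Omega> \<or> R = \<Omega> \<times> \<Omega>)"

definition synchronizes :: "'a set \<Rightarrow> ('a \<Rightarrow> 'a) set \<Rightarrow> ('a \<Rightarrow> 'a) \<Rightarrow> bool" where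
  "synchronizes \<Omega> G f \<longleftrightarrow>
     (\<exists>c \<in> \<Omega>. (\<lambda>x \<in> \<Omega>. c) \<in> transformation_semigroup \<Omega> (insert f G))"

definition graph_X :: "(nat \<times> nat) pair_pre_digraph" where
  "graph_X = complement_graph (complete_graph 4 \<box> complete_graph 4)"

definition graph_Gamma :: "((nat \<times> nat) \<times> (nat \<times> nat)) pair_pre_digraph" where
  "graph_Gamma = graph_X \<box> graph_X"

end

theory Submission
  imports Defs "HOL-Combinatorics.Permutations"
begin

text \<open>
  The complement of \<open>K\<^sub>n \<box> K\<^sub>n\<close> is the direct product of two complete graphs: its
  vertices are pairs, adjacent when both entries differ. Hence a homomorphism from
  \<open>K\<^sub>n \<box> K\<^sub>n\<close> into it is a pair of arrays in which the entries of every row and of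
  every column are distinct, that is, a pair of Latin squares \<open>P\<close>, \<open>Q\<close> of order \<open>n\<close>. Keeping
  only the first entry of each factor maps the square of this graph onto
  \<open>K\<^sub>n \<box> K\<^sub>n\<close>, and the square contains copies of the graph as fibres. Composing these
  maps gives the endomorphism \<open>((a, b), (c, d)) \<mapsto> ((0, 0), (P a c, Q a c))\<close>
  (\<open>superposition_map_endomorphism\<close>). Its rank is the number of distinct symbol pairs when \<open>P\<close> and
  \<open>Q\<close> are superposed, and each kernel class has size \<open>n\<^sup>2\<close> times the multiplicity of a pair
  (\<open>card_superposition_map_fibre\<close>). So for \<open>n = 4\<close> the three endomorphisms amount to three pairs
  of Latin squares of order four whose superpositions have 6, 9 and 12 distinct pairs with the
  right multiplicities.

  The automorphism group contains all permutations of the single coordinates and enough exchanges of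
  coordinates to be transitive on them. This part of the group alone is already
  primitive as soon as there are three symbols
  (\<open>coordinate_invariant_equivalence_trivial\<close>). Finally, automorphisms and an endomorphism generate
  a semigroup of endomorphisms, and a constant map is not an endomorphism of a graph with an edge
  (\<open>endomorphism_not_synchronized\<close>).
\<close>

section \<open>Simple graphs and their endomorphisms\<close>

lemma graph_endomorphismsD:
  assumes "f \<in> graph_endomorphisms G"
  shows "f \<in> pverts G \<rightarrow>\<^sub>E pverts G" and "(u, v) \<in> parcs G \<Longrightarrow> (f u, f v) \<in> parcs G"
  using assms by (auto simp: graph_endomorphisms_def)

lemma automorphism_imp_endomorphism:
  assumes "pair_graph G"
  shows "graph_automorphisms G \<subseteq> graph_endomorphisms G"
proof -
  interpret pair_graph G by fact
  show ?thesis
    unfolding graph_automorphisms_def graph_endomorphisms_def Bij_def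
    by (auto simp: PiE_def bij_betw_apply dest: in_arcsD1 in_arcsD2)
qed

lemma endomorphism_semigroup:
  assumes "pair_graph G" and "S \<subseteq> graph_endomorphisms G"
  shows "transformation_semigroup (pverts G) S \<subseteq> graph_endomorphisms G"
proof
  interpret pair_graph G by fact
  fix f assume "f \<in> transformation_semigroup (pverts G) S"
  then show "f \<in> graph_endomorphisms G"
  proof induction
    case (generator f)
    then show ?case using assms(2) by blast
  next
    case (composition f g)
    note f = graph_endomorphismsD[OF composition.IH(1)]
    note g = graph_endomorphismsD[OF composition.IH(2)]
    have "compose (pverts G) f g \<in> pverts G \<rightarrow>\<^sub>E pverts G"
      using f(1) g(1) by (auto simp: compose_def)
    moreover have "(compose (pverts G) f g u, compose (pverts G) f g v) \<in> parcs G"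
      if "(u, v) \<in> parcs G" for u v
      using that f(2)[OF g(2)[OF that]] in_arcsD1[OF that] in_arcsD2[OF that]
      by (simp add: compose_def)
    ultimately show ?case unfolding graph_endomorphisms_def by blast
  qed
qed

text \<open>
  A constant map would send an edge to a loop. This is why endomorphisms of graphs are the source
  of maps that a permutation group cannot synchronize.
\<close>

lemma endomorphism_not_synchronized:
  assumes G: "pair_graph G" and "parcs G \<noteq> {}" and "f \<in> graph_endomorphisms G"
  shows "\<not> synchronizes (pverts G) (graph_automorphisms G) f"
proof
  interpret pair_graph G by fact
  assume "synchronizes (pverts G) (graph_automorphisms G) f"
  then obtain c where
    "(\<lambda>x \<in> pverts G. c) \<in> transformation_semigroup (pverts G) (insert f (graph_automorphisms G))"
    unfolding synchronizes_def by blast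
  then have const: "(\<lambda>x \<in> pverts G. c) \<in> graph_endomorphisms G"
    using endomorphism_semigroup[OF G] automorphism_imp_endomorphism[OF G] assms(3) by blast
  obtain u v where uv: "(u, v) \<in> parcs G" using assms(2) by auto
  then have "(c, c) \<in> parcs G"
    using graph_endomorphismsD(2)[OF const uv] in_arcsD1 in_arcsD2 by simp
  then show False using pair_no_loops by force
qed

lemma subgroup_graph_automorphisms:
  "subgroup (graph_automorphisms G) (BijGroup (pverts G))"
proof (rule group.subgroupI[OF group_BijGroup])
  show "graph_automorphisms G \<subseteq> carrier (BijGroup (pverts G))"
    by (auto simp: graph_automorphisms_def BijGroup_def)
  have "(\<lambda>x \<in> pverts G. x) \<in> graph_automorphisms G"
    by (simp add: graph_automorphisms_def id_Bij)
  then show "graph_automorphisms G \<noteq> {}" by blast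
next
  fix g assume g: "g \<in> graph_automorphisms G"
  let ?h = "\<lambda>x \<in> pverts G. inv_into (pverts G) g x"
  have bij: "g \<in> Bij (pverts G)"
    using g by (simp add: graph_automorphisms_def)
  have arcs: "(u, v) \<in> parcs G \<longleftrightarrow> (g u, g v) \<in> parcs G"
    if "u \<in> pverts G" "v \<in> pverts G" for u v
    using g that by (simp add: graph_automorphisms_def)
  have surj: "g ` pverts G = pverts G"
    using bij by (simp add: Bij_def bij_betw_def)
  have "(u, v) \<in> parcs G \<longleftrightarrow> (?h u, ?h v) \<in> parcs G"
    if "u \<in> pverts G" "v \<in> pverts G" for u v
    using arcs[OF Bij_inv_into_mem[OF bij that(1)] Bij_inv_into_mem[OF bij that(2)]] that surj
    by (simp add: f_inv_into_f)
  then have "?h \<in> graph_automorphisms G"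
    using restrict_inv_into_Bij[OF bij] unfolding graph_automorphisms_def by blast
  then show "inv\<^bsub>BijGroup (pverts G)\<^esub> g \<in> graph_automorphisms G"
    by (simp add: inv_BijGroup[OF bij])
next
  fix g h assume gh: "g \<in> graph_automorphisms G" "h \<in> graph_automorphisms G"
  then have bij: "g \<in> Bij (pverts G)" "h \<in> Bij (pverts G)"
    by (auto simp: graph_automorphisms_def)
  have "compose (pverts G) g h \<in> graph_automorphisms G"
    using gh compose_Bij[OF bij] funcset_mem[OF Bij_imp_funcset[OF bij(2)]]
    by (simp add: graph_automorphisms_def compose_def)
  then show "g \<otimes>\<^bsub>BijGroup (pverts G)\<^esub> h \<in> graph_automorphisms G"
    using bij by (simp add: BijGroup_def)
qed

lemma restrict_in_graph_automorphisms:
  assumes "finite (pverts G)" and "g \<in> pverts G \<rightarrow> pverts G" and "inj_on g (pverts G)"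
    and "\<And>u v. \<lbrakk>u \<in> pverts G; v \<in> pverts G\<rbrakk> \<Longrightarrow> (u, v) \<in> parcs G \<longleftrightarrow> (g u, g v) \<in> parcs G"
  shows "restrict g (pverts G) \<in> graph_automorphisms G"
proof -
  have "g ` pverts G = pverts G"
    using assms(1-3) by (intro endo_inj_surj) auto
  then have "bij_betw (restrict g (pverts G)) (pverts G) (pverts G)"
    using assms(3) by (simp add: bij_betw_def)
  then show ?thesis
    using assms(4) by (simp add: graph_automorphisms_def Bij_def)
qed

lemma pair_graphI:
  assumes "finite (pverts G)" and "parcs G \<subseteq> pverts G \<times> pverts G" and "sym (parcs G)"
    and "\<And>v. (v, v) \<notin> parcs G"
  shows "pair_graph G"
  using assms
  by unfold_locales (auto simp: symmetric_def arcs_ends_def arc_to_ends_def intro: finite_subset)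

lemma pair_graph_complete: "pair_graph (complete_graph n)"
  by (rule pair_graphI) (auto simp: complete_graph_def sym_def)

lemma pair_graph_complement:
  assumes "pair_graph G"
  shows "pair_graph (complement_graph G)"
proof -
  interpret pair_graph G by fact
  show ?thesis
    by (rule pair_graphI) (auto simp: complement_graph_def sym_def dest: arcs_symmetric)
qed

lemma pair_graph_cartesian_product:
  assumes "pair_graph Y" and "pair_graph Z"
  shows "pair_graph (Y \<box> Z)"
proof -
  interpret Y: pair_graph Y by fact
  interpret Z: pair_graph Z by fact
  show ?thesis
    by (rule pair_graphI)
      (auto simp: cartesian_product_def sym_def
        dest: Y.arcs_symmetric Z.arcs_symmetric Y.pair_no_loops Z.pair_no_loops)
qed

section \<open>The square of the complement of a rook graph\<close>

definition rook_complement :: "nat \<Rightarrow> (nat \<times> nat) pair_pre_digraph" where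
  "rook_complement n = complement_graph (complete_graph n \<box> complete_graph n)"

definition rook_complement_square ::
    "nat \<Rightarrow> ((nat \<times> nat) \<times> (nat \<times> nat)) pair_pre_digraph" where
  "rook_complement_square n = rook_complement n \<box> rook_complement n"

lemma graph_Gamma_eq: "graph_Gamma = rook_complement_square 4"
  by (simp add: graph_Gamma_def graph_X_def rook_complement_square_def rook_complement_def)

lemma pair_graph_rook_complement_square: "pair_graph (rook_complement_square n)"
  unfolding rook_complement_square_def rook_complement_def
  by (intro pair_graph_cartesian_product pair_graph_complement pair_graph_complete)

lemma pverts_rook_complement_square:
  "pverts (rook_complement_square n) = ({..<n} \<times> {..<n}) \<times> ({..<n} \<times> {..<n})"
  by (simp add: rook_complement_square_def rook_complement_def cartesian_product_def
      complement_graph_def complete_graph_def)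

lemma parcs_rook_complement:
  "((a, b), (a', b')) \<in> parcs (rook_complement n) \<longleftrightarrow>
     a < n \<and> b < n \<and> a' < n \<and> b' < n \<and> a \<noteq> a' \<and> b \<noteq> b'"
  by (auto simp: rook_complement_def cartesian_product_def complement_graph_def complete_graph_def)

lemma parcs_rook_complement_square:
  "(((a, b), (c, d)), ((a', b'), (c', d'))) \<in> parcs (rook_complement_square n) \<longleftrightarrow>
     {a, b, c, d, a', b', c', d'} \<subseteq> {..<n} \<and>
     (a = a' \<and> b = b' \<and> c \<noteq> c' \<and> d \<noteq> d' \<or> c = c' \<and> d = d' \<and> a \<noteq> a' \<and> b \<noteq> b')"
  unfolding rook_complement_square_def cartesian_product_def
  by (auto simp: parcs_rook_complement)
    (auto simp: rook_complement_def cartesian_product_def complement_graph_def complete_graph_def)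

section \<open>Primitivity\<close>

definition coordinatewise :: "(nat \<Rightarrow> nat) \<Rightarrow> (nat \<Rightarrow> nat) \<Rightarrow> (nat \<Rightarrow> nat) \<Rightarrow> (nat \<Rightarrow> nat) \<Rightarrow>
    (nat \<times> nat) \<times> (nat \<times> nat) \<Rightarrow> (nat \<times> nat) \<times> (nat \<times> nat)" where
  "coordinatewise p q r s = map_prod (map_prod p q) (map_prod r s)"

abbreviation swap_first :: "('a \<times> 'a) \<times> 'b \<Rightarrow> ('a \<times> 'a) \<times> 'b" where
  "swap_first \<equiv> map_prod prod.swap id"

lemma coordinatewise_automorphism:
  assumes "p permutes {..<n}" "q permutes {..<n}" "r permutes {..<n}" "s permutes {..<n}"
  shows "restrict (coordinatewise p q r s) (pverts (rook_complement_square n))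
    \<in> graph_automorphisms (rook_complement_square n)"
proof (rule restrict_in_graph_automorphisms)
  have mem: "f x < n \<longleftrightarrow> x < n" if "f permutes {..<n}" for f x
    using permutes_in_image[OF that] by simp
  have inj: "f x = f y \<longleftrightarrow> x = y" if "f permutes {..<n}" for f and x y :: nat
    using permutes_inj[OF that] by (simp add: inj_eq)
  note eqs = assms[THEN mem] assms[THEN inj]
  show "finite (pverts (rook_complement_square n))"
    by (simp add: pverts_rook_complement_square)
  show "coordinatewise p q r s \<in> pverts (rook_complement_square n) \<rightarrow> pverts (rook_complement_square n)"
    by (auto simp: pverts_rook_complement_square coordinatewise_def eqs)
  show "inj_on (coordinatewise p q r s) (pverts (rook_complement_square n))"
    by (auto simp: inj_on_def coordinatewise_def eqs)
  show "(u, v) \<in> parcs (rook_complement_square n) \<longleftrightarrow>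
      (coordinatewise p q r s u, coordinatewise p q r s v) \<in> parcs (rook_complement_square n)" for u v
    by (cases u; cases v)
      (auto simp: coordinatewise_def parcs_rook_complement_square eqs)
qed

lemma swap_first_automorphism:
  "restrict swap_first (pverts (rook_complement_square n))
    \<in> graph_automorphisms (rook_complement_square n)"
  by (rule restrict_in_graph_automorphisms)
    (auto simp: pverts_rook_complement_square parcs_rook_complement_square inj_on_def)

lemma swap_automorphism:
  "restrict prod.swap (pverts (rook_complement_square n))
    \<in> graph_automorphisms (rook_complement_square n)"
  by (rule restrict_in_graph_automorphisms)
    (auto simp: pverts_rook_complement_square parcs_rook_complement_square inj_on_def)

lemma permutes_transitive:
  assumes "x \<in> S" "y \<in> S"
  obtains p where "p permutes S" "p x = y"
  using permutes_swap_id[OF assms] by (rule that) simp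

lemma permutes_2_transitive:
  assumes "x \<in> S" "x' \<in> S" "y \<in> S" "y' \<in> S" "x \<noteq> x'" "y \<noteq> y'"
  obtains p where "p permutes S" "p x = y" "p x' = y'"
proof
  let ?z = "transpose x y x'"
  have "?z \<in> S" using assms by (auto simp: transpose_def)
  then show "transpose ?z y' \<circ> transpose x y permutes S"
    using assms by (intro permutes_compose permutes_swap_id)
  show "(transpose ?z y' \<circ> transpose x y) x = y" "(transpose ?z y' \<circ> transpose x y) x' = y'"
    using assms by (auto simp: transpose_def)
qed

text \<open>
  Two related points that differ in some coordinate can be moved so that they differ in the first
  one. A transposition in that coordinate which fixes the entry of one point and moves the entry of
  the other, available because there are three symbols, then produces two related points
  that differ in this coordinate only. All such pairs are images of one another, and changing the
  coordinates one by one connects any two points.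
\<close>

lemma coordinate_invariant_equivalence_trivial:
  assumes n: "3 \<le> n" and V: "V = ({..<n} \<times> {..<n}) \<times> ({..<n} \<times> {..<n})" and R: "equiv V R"
    and perm: "\<And>p q r s x y. \<lbrakk>p permutes {..<n}; q permutes {..<n}; r permutes {..<n};
      s permutes {..<n}; (x, y) \<in> R\<rbrakk> \<Longrightarrow> (coordinatewise p q r s x, coordinatewise p q r s y) \<in> R"
    and swap_first: "\<And>x y. (x, y) \<in> R \<Longrightarrow> (swap_first x, swap_first y) \<in> R"
    and swap: "\<And>x y. (x, y) \<in> R \<Longrightarrow> (prod.swap x, prod.swap y) \<in> R"
  shows "R = Id_on V \<or> R = V \<times> V"
proof (cases "R \<subseteq> Id")
  case True
  have "R \<subseteq> V \<times> V" "refl_on V R" using R by (auto simp: equiv_def)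
  then have "R = Id_on V" using True by (auto simp: refl_on_def)
  then show ?thesis ..
next
  case False
  have sub: "R \<subseteq> V \<times> V" and sym: "sym R" and trans: "trans R"
    using R by (auto simp: equiv_def)
  obtain u v where uv: "(u, v) \<in> R" "u \<noteq> v" using False by (metis IdI subrelI)
  \<comment> \<open>Bring a coordinate in which the two points differ to the front.\<close>
  have "\<exists>u v. (u, v) \<in> R \<and> fst (fst u) \<noteq> fst (fst v)"
  proof -
    obtain a b c d a' b' c' d' where eq: "u = ((a, b), (c, d))" "v = ((a', b'), (c', d'))"
      by (metis prod.collapse)
    consider "a \<noteq> a'" | "b \<noteq> b'" | "c \<noteq> c'" | "d \<noteq> d'" using uv(2) eq by auto
    then show ?thesis
    proof cases
      case 1 then show ?thesis using uv(1) eq by force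
    next
      case 2 then show ?thesis using swap_first[OF uv(1)] eq by force
    next
      case 3 then show ?thesis using swap[OF uv(1)] eq by force
    next
      case 4 then show ?thesis using swap_first[OF swap[OF uv(1)]] eq by force
    qed
  qed
  then obtain a b c d a' b' c' d' where
    *: "(((a, b), (c, d)), ((a', b'), (c', d'))) \<in> R" and "a \<noteq> a'"
    by force
  then have less: "a < n" "a' < n" "b' < n" "c' < n" "d' < n" using sub V by auto
  have "\<not> {..<n} \<subseteq> {a, a'}"
    using n card_mono[of "{a, a'}" "{..<n}"] card_insert_le_m1[of 2 "{a'}" a] by fastforce
  then obtain a'' where a'': "a'' < n" "a'' \<noteq> a" "a'' \<noteq> a'" by auto
  \<comment> \<open>The transposition of \<open>a'\<close> and \<open>a''\<close> fixes the left point and moves the right one.\<close>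
  have "(((a, b), (c, d)), ((a'', b'), (c', d'))) \<in> R"
    using perm[OF permutes_swap_id permutes_id permutes_id permutes_id *, of a' a'']
      less a'' \<open>a \<noteq> a'\<close>
    by (simp add: coordinatewise_def)
  then have base: "(((a', b'), (c', d')), ((a'', b'), (c', d'))) \<in> R"
    using * sym trans by (meson symD transD)
  have first: "(((x, y), (z, w)), ((x', y), (z, w))) \<in> R"
    if xs: "x < n" "x' < n" "y < n" "z < n" "w < n" for x x' y z w
  proof (cases "x = x'")
    case True
    then show ?thesis using R xs V by (auto simp: equiv_def refl_on_def)
  next
    case False
    obtain p where "p permutes {..<n}" "p a' = x" "p a'' = x'"
      using permutes_2_transitive[of a' "{..<n}" a'' x x'] xs less a'' False by auto
    moreover obtain q where "q permutes {..<n}" "q b' = y"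
      using permutes_transitive[of b' "{..<n}" y] xs less by auto
    moreover obtain r where "r permutes {..<n}" "r c' = z"
      using permutes_transitive[of c' "{..<n}" z] xs less by auto
    moreover obtain s where "s permutes {..<n}" "s d' = w"
      using permutes_transitive[of d' "{..<n}" w] xs less by auto
    ultimately show ?thesis
      using perm[OF _ _ _ _ base, of p q r s] by (simp add: coordinatewise_def)
  qed
  have second: "(((x, y), (z, w)), ((x, y'), (z, w))) \<in> R"
    if "x < n" "y < n" "y' < n" "z < n" "w < n" for x y y' z w
    using swap_first[OF first[of y y' x z w]] that by simp
  have left: "(((x, y), t), ((x', y'), t)) \<in> R"
    if "x < n" "y < n" "x' < n" "y' < n" "t \<in> {..<n} \<times> {..<n}" for x y x' y' t
    using first[of x x' y "fst t" "snd t"] second[of x' y y' "fst t" "snd t"] that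
      transD[OF trans] by fastforce
  have right: "((t, (z, w)), (t, (z', w'))) \<in> R"
    if "z < n" "w < n" "z' < n" "w' < n" "t \<in> {..<n} \<times> {..<n}" for z w z' w' t
    using swap[OF left[OF that]] by simp
  have "(x, y) \<in> R" if "x \<in> V" "y \<in> V" for x y
  proof -
    obtain x1 x2 x3 x4 y1 y2 y3 y4
      where "x = ((x1, x2), (x3, x4))" "y = ((y1, y2), (y3, y4))"
      by (metis prod.collapse)
    then show ?thesis
      using that V left[of x1 x2 y1 y2 "(x3, x4)"] right[of x3 x4 y3 y4 "(y1, y2)"]
        transD[OF trans] by fastforce
  qed
  then have "R = V \<times> V" using sub by auto
  then show ?thesis ..
qed

lemma primitive_rook_complement_square:
  assumes "3 \<le> n"
  shows "primitive_group (pverts (rook_complement_square n))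
    (graph_automorphisms (rook_complement_square n))"
proof -
  let ?V = "pverts (rook_complement_square n)" and ?A = "graph_automorphisms (rook_complement_square n)"
  have sub: "subgroup ?A (BijGroup ?V)" by (rule subgroup_graph_automorphisms)
  have "group_hom (BijGroup ?V\<lparr>carrier := ?A\<rparr>) (BijGroup ?V) (\<lambda>g. g)"
    using sub group.subgroup_imp_group[OF group_BijGroup sub] group_BijGroup subgroup.subset[OF sub]
    by (auto simp: group_hom_def group_hom_axioms_def hom_def)
  moreover have "\<exists>g \<in> ?A. g x = y" if x: "x \<in> ?V" and y: "y \<in> ?V" for x y
  proof -
    obtain x1 x2 x3 x4 y1 y2 y3 y4
      where eq: "x = ((x1, x2), (x3, x4))" "y = ((y1, y2), (y3, y4))"
      by (metis prod.collapse)
    have less: "{x1, x2, x3, x4, y1, y2, y3, y4} \<subseteq> {..<n}"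
      using x y eq by (simp add: pverts_rook_complement_square)
    obtain p where p: "p permutes {..<n}" "p x1 = y1"
      using permutes_transitive[of x1 "{..<n}" y1] less by auto
    obtain q where q: "q permutes {..<n}" "q x2 = y2"
      using permutes_transitive[of x2 "{..<n}" y2] less by auto
    obtain r where r: "r permutes {..<n}" "r x3 = y3"
      using permutes_transitive[of x3 "{..<n}" y3] less by auto
    obtain s where s: "s permutes {..<n}" "s x4 = y4"
      using permutes_transitive[of x4 "{..<n}" y4] less by auto
    have "restrict (coordinatewise p q r s) ?V x = y"
      using x p q r s eq by (simp add: coordinatewise_def)
    then show ?thesis using coordinatewise_automorphism[OF p(1) q(1) r(1) s(1)] by blast
  qed
  ultimately have trans: "transitive_action (BijGroup ?V\<lparr>carrier := ?A\<rparr>) ?V (\<lambda>g. g)"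
    by (simp add: transitive_action_def group_action_def transitive_action_axioms_def)
  have "R = Id_on ?V \<or> R = ?V \<times> ?V"
    if R: "equiv ?V R" and inv: "\<forall>g \<in> ?A. \<forall>(x, y) \<in> R. (g x, g y) \<in> R" for R
  proof (rule coordinate_invariant_equivalence_trivial[OF assms pverts_rook_complement_square R])
    have restrict: "(g x, g y) \<in> R" if "restrict g ?V \<in> ?A" "(x, y) \<in> R" for g x y
    proof -
      have "x \<in> ?V" "y \<in> ?V" using R that(2) by (auto simp: equiv_def)
      then show ?thesis using inv that by fastforce
    qed
    show "(coordinatewise p q r s x, coordinatewise p q r s y) \<in> R"
      if "p permutes {..<n}" "q permutes {..<n}" "r permutes {..<n}" "s permutes {..<n}" "(x, y) \<in> R"
      for p q r s x y
      using restrict[OF coordinatewise_automorphism] that by blast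
    show "(swap_first x, swap_first y) \<in> R" if "(x, y) \<in> R" for x y
      by (rule restrict[OF swap_first_automorphism that])
    show "(prod.swap x, prod.swap y) \<in> R" if "(x, y) \<in> R" for x y
      by (rule restrict[OF swap_automorphism that])
  qed
  then show ?thesis using sub trans unfolding primitive_group_def by blast
qed

section \<open>Kernel classes and superposed Latin squares\<close>

lemma card_kernel_classes_of_size:
  "card (kernel_classes_of_size \<Omega> f k) = card {y \<in> f ` \<Omega>. card {x \<in> \<Omega>. f x = y} = k}"
proof -
  have "kernel_classes_of_size \<Omega> f k =
      (\<lambda>y. {x \<in> \<Omega>. f x = y}) ` {y \<in> f ` \<Omega>. card {x \<in> \<Omega>. f x = y} = k}"
    unfolding kernel_classes_of_size_def kernel_classes_def by auto
  moreover have "inj_on (\<lambda>y. {x \<in> \<Omega>. f x = y}) (f ` \<Omega>)"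
    by (auto simp: inj_on_def)
  ultimately show ?thesis
    by (metis (no_types, lifting) card_image inj_on_subset mem_Collect_eq subsetI)
qed

lemma non_uniformI:
  assumes "card (kernel_classes_of_size \<Omega> f k) \<noteq> 0" and "card (kernel_classes_of_size \<Omega> f m) \<noteq> 0"
    and "k \<noteq> m"
  shows "non_uniform \<Omega> f"
proof -
  have "kernel_classes_of_size \<Omega> f k \<noteq> {}" "kernel_classes_of_size \<Omega> f m \<noteq> {}"
    using assms(1,2) by (metis card.empty)+
  then show ?thesis
    using assms(3) by (fastforce simp: non_uniform_def kernel_classes_of_size_def)
qed

definition latin_square :: "nat \<Rightarrow> (nat \<Rightarrow> nat \<Rightarrow> nat) \<Rightarrow> bool" where
  "latin_square n L \<longleftrightarrow>
     (\<forall>i<n. \<forall>j<n. L i j < n \<and> (\<forall>k<n. j \<noteq> k \<longrightarrow> L i j \<noteq> L i k \<and> L j i \<noteq> L k i))"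

text \<open>
  Only the multiset of symbol pairs matters; it is given as a list so that ranks and
  multiplicities can be computed by rewriting.
\<close>

definition superposition ::
    "nat \<Rightarrow> (nat \<Rightarrow> nat \<Rightarrow> nat) \<Rightarrow> (nat \<Rightarrow> nat \<Rightarrow> nat) \<Rightarrow> (nat \<times> nat) list" where
  "superposition n P Q = map (\<lambda>(i, j). (P i j, Q i j)) (List.product [0..<n] [0..<n])"

text \<open>
  The entries \<open>a\<close> and \<open>c\<close> address a cell of an \<open>n \<times> n\<close> array, and edges become pairs of cells in
  a common row or column. The target of the cell lies in the fibre over the arbitrary base vertex
  \<open>(0, 0)\<close>, which is a copy of the complement of the rook graph.
\<close>

definition superposition_map :: "nat \<Rightarrow> (nat \<Rightarrow> nat \<Rightarrow> nat) \<Rightarrow> (nat \<Rightarrow> nat \<Rightarrow> nat) \<Rightarrow>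
    (nat \<times> nat) \<times> (nat \<times> nat) \<Rightarrow> (nat \<times> nat) \<times> (nat \<times> nat)" where
  "superposition_map n P Q =
     (\<lambda>((a, b), (c, d)) \<in> pverts (rook_complement_square n). ((0, 0), (P a c, Q a c)))"

text \<open>
  Adjacent vertices lie in distinct cells of a common row or column, where both symbols of the
  superposition change; that is adjacency in the complement of the rook graph.
\<close>

lemma superposition_map_endomorphism:
  assumes "latin_square n P" and "latin_square n Q"
  shows "superposition_map n P Q \<in> graph_endomorphisms (rook_complement_square n)"
proof -
  have less: "P i j < n" "Q i j < n" if "i < n" "j < n" for i j
    using assms that by (auto simp: latin_square_def)
  have row: "P i j \<noteq> P i k" "Q i j \<noteq> Q i k" and col: "P j i \<noteq> P k i" "Q j i \<noteq> Q k i"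
    if "i < n" "j < n" "k < n" "j \<noteq> k" for i j k
    using assms that unfolding latin_square_def by blast+
  have "(superposition_map n P Q u, superposition_map n P Q v) \<in> parcs (rook_complement_square n)"
    if uv: "(u, v) \<in> parcs (rook_complement_square n)" for u v
  proof -
    obtain a b c d a' b' c' d' where eq: "u = ((a, b), (c, d))" "v = ((a', b'), (c', d'))"
      by (metis prod.collapse)
    show ?thesis
      using uv unfolding eq parcs_rook_complement_square
      by (auto simp: superposition_map_def pverts_rook_complement_square
          parcs_rook_complement_square less row col)
  qed
  moreover have "superposition_map n P Q \<in>
      pverts (rook_complement_square n) \<rightarrow>\<^sub>E pverts (rook_complement_square n)"
    by (auto simp: superposition_map_def pverts_rook_complement_square less)
  ultimately show ?thesis unfolding graph_endomorphisms_def by blast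
qed

lemma superposition_map_image:
  "superposition_map n P Q ` pverts (rook_complement_square n) =
     Pair (0, 0) ` set (superposition n P Q)"
proof (intro equalityI subsetI)
  fix y assume "y \<in> superposition_map n P Q ` pverts (rook_complement_square n)"
  then obtain a b c d where "a < n" "b < n" "c < n" "d < n" "y = ((0, 0), (P a c, Q a c))"
    by (auto simp: superposition_map_def pverts_rook_complement_square)
  then show "y \<in> Pair (0, 0) ` set (superposition n P Q)"
    by (force simp: superposition_def)
next
  fix y :: "(nat \<times> nat) \<times> (nat \<times> nat)"
  assume "y \<in> Pair (0, 0) ` set (superposition n P Q)"
  then obtain a c where ac: "a < n" "c < n" "y = ((0, 0), (P a c, Q a c))"
    by (auto simp: superposition_def)
  then have "((a, a), (c, c)) \<in> pverts (rook_complement_square n)"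
    and "y = superposition_map n P Q ((a, a), (c, c))"
    by (auto simp: superposition_map_def pverts_rook_complement_square)
  then show "y \<in> superposition_map n P Q ` pverts (rook_complement_square n)" by blast
qed

text \<open>
  A cell \<open>(a, c)\<close> with a given symbol pair is reached once for each choice of the entries \<open>b\<close> and
  \<open>d\<close>; this is the factor \<open>n\<^sup>2\<close>.
\<close>

lemma card_superposition_map_fibre:
  "card {x \<in> pverts (rook_complement_square n). superposition_map n P Q x = ((0, 0), e)} =
     n\<^sup>2 * count_list (superposition n P Q) e"
proof -
  let ?V = "pverts (rook_complement_square n)"
  let ?C = "{(a, c) \<in> {..<n} \<times> {..<n}. (P a c, Q a c) = e}"
  let ?cells = "filter (\<lambda>(i, j). e = (P i j, Q i j)) (List.product [0..<n] [0..<n])"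
  have "{x \<in> ?V. superposition_map n P Q x = ((0, 0), e)} =
      (\<lambda>((a, c), (b, d)). ((a, b), (c, d))) ` (?C \<times> ({..<n} \<times> {..<n}))"
    by (force simp: superposition_map_def pverts_rook_complement_square image_iff)
  moreover have "inj_on (\<lambda>((a, c), (b, d)). ((a, b), (c, d))) (?C \<times> ({..<n} \<times> {..<n}))"
    by (auto simp: inj_on_def)
  ultimately have "card {x \<in> ?V. superposition_map n P Q x = ((0, 0), e)} = card ?C * n\<^sup>2"
    by (simp add: card_image card_cartesian_product power2_eq_square)
  moreover have "card ?C = length ?cells"
  proof -
    have "?C = set ?cells" by auto
    moreover have "distinct ?cells" by (simp add: distinct_product)
    ultimately show ?thesis by (simp only: distinct_card)
  qed
  moreover have "count_list (superposition n P Q) e = length ?cells"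
    by (simp add: superposition_def count_list_eq_length_filter filter_map o_def case_prod_unfold)
  ultimately show ?thesis by simp
qed

lemma map_rank_superposition_map:
  "map_rank (pverts (rook_complement_square n)) (superposition_map n P Q) =
     card (set (superposition n P Q))"
  by (simp add: map_rank_def superposition_map_image card_image inj_on_def)

lemma card_kernel_classes_superposition_map:
  assumes "0 < n" and "k = n\<^sup>2 * m"
  shows "card (kernel_classes_of_size (pverts (rook_complement_square n)) (superposition_map n P Q) k)
    = card {e \<in> set (superposition n P Q). count_list (superposition n P Q) e = m}"
proof -
  let ?V = "pverts (rook_complement_square n)" and ?f = "superposition_map n P Q"
  have "{y \<in> ?f ` ?V. card {x \<in> ?V. ?f x = y} = k} =
      Pair (0, 0) ` {e \<in> set (superposition n P Q). count_list (superposition n P Q) e = m}"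
    using assms by (auto simp: superposition_map_image card_superposition_map_fibre)
  then show ?thesis
    by (simp add: card_kernel_classes_of_size card_image inj_on_def)
qed

section \<open>Three pairs of Latin squares of order four\<close>

definition square_of :: "nat list list \<Rightarrow> nat \<Rightarrow> nat \<Rightarrow> nat" where
  "square_of rows i j = rows ! i ! j"

text \<open>
  The first square is the Cayley table of the Klein four-group.
\<close>

definition klein_square :: "nat \<Rightarrow> nat \<Rightarrow> nat" where
  "klein_square = square_of [[0, 1, 2, 3], [1, 0, 3, 2], [2, 3, 0, 1], [3, 2, 1, 0]]"

text \<open>
  In the lower right corner of the Klein table the symbols 0 and 1 form a subsquare of order two;
  here they are exchanged.
\<close>

definition switched_square :: "nat \<Rightarrow> nat \<Rightarrow> nat" where
  "switched_square = square_of [[0, 1, 2, 3], [1, 0, 3, 2], [2, 3, 1, 0], [3, 2, 0, 1]]"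

definition cyclic_square :: "nat \<Rightarrow> nat \<Rightarrow> nat" where
  "cyclic_square = square_of [[0, 1, 2, 3], [1, 2, 3, 0], [2, 3, 0, 1], [3, 0, 1, 2]]"

text \<open>
  This is the Klein table with its last two rows exchanged.
\<close>

definition row_exchanged_square :: "nat \<Rightarrow> nat \<Rightarrow> nat" where
  "row_exchanged_square = square_of [[0, 1, 2, 3], [1, 0, 3, 2], [3, 2, 1, 0], [2, 3, 0, 1]]"

lemma latin_squares:
  "latin_square 4 klein_square" "latin_square 4 switched_square"
  "latin_square 4 cyclic_square" "latin_square 4 row_exchanged_square"
  by code_simp+

text \<open>
  The two squares agree except in the lower right corner. So the symbols 2 and 3 contribute
  \<open>(2, 2)\<close> and \<open>(3, 3)\<close>, four times each, whereas the symbols 0 and 1 give each of \<open>(0, 0)\<close>,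
  \<open>(1, 1)\<close> outside the corner and \<open>(0, 1)\<close>, \<open>(1, 0)\<close> inside it twice.
\<close>

lemma superposition_klein_switched:
  defines "L \<equiv> superposition 4 klein_square switched_square"
  shows "card (set L) = 6"
    "card {e \<in> set L. count_list L e = 2} = 4" "card {e \<in> set L. count_list L e = 4} = 2"
  unfolding L_def by code_simp+

text \<open>
  The symbol 3 occupies the same four cells in both squares, which accounts for the pair of
  multiplicity four. The other twelve cells contribute the remaining eight pairs.
\<close>

lemma superposition_cyclic_switched:
  defines "L \<equiv> superposition 4 cyclic_square switched_square"
  shows "card (set L) = 9"
    "card {e \<in> set L. count_list L e = 1} = 4" "card {e \<in> set L. count_list L e = 2} = 4"
    "card {e \<in> set L. count_list L e = 4} = 1"
  unfolding L_def by code_simp+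

lemma superposition_cyclic_row_exchanged:
  defines "L \<equiv> superposition 4 cyclic_square row_exchanged_square"
  shows "card (set L) = 12"
    "card {e \<in> set L. count_list L e = 1} = 8" "card {e \<in> set L. count_list L e = 2} = 4"
  unfolding L_def by code_simp+

theorem mainTheorem6:
  fixes \<Gamma> :: "((nat \<times> nat) \<times> (nat \<times> nat)) pair_pre_digraph"
    and V :: "((nat \<times> nat) \<times> (nat \<times> nat)) set"
  assumes "\<Gamma> = graph_Gamma" and "V = pverts \<Gamma>"
  shows "pair_graph \<Gamma> \<and> card V = 256 \<and> primitive_group V (graph_automorphisms \<Gamma>) \<and>
    (\<exists>f \<in> graph_endomorphisms \<Gamma>. non_uniform V f \<and> map_rank V f = 6 \<and>
       card (kernel_classes_of_size V f 32) = 4 \<and>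
       card (kernel_classes_of_size V f 64) = 2) \<and>
    (\<exists>f \<in> graph_endomorphisms \<Gamma>. non_uniform V f \<and> map_rank V f = 9 \<and>
       card (kernel_classes_of_size V f 16) = 4 \<and>
       card (kernel_classes_of_size V f 32) = 4 \<and>
       card (kernel_classes_of_size V f 64) = 1) \<and>
    (\<exists>f \<in> graph_endomorphisms \<Gamma>. non_uniform V f \<and> map_rank V f = 12 \<and>
       card (kernel_classes_of_size V f 16) = 8 \<and>
       card (kernel_classes_of_size V f 32) = 4) \<and>
    (\<exists>f \<in> V \<rightarrow>\<^sub>E V. map_rank V f = 6 \<and> non_uniform V f \<and>
       \<not> synchronizes V (graph_automorphisms \<Gamma>) f)"
proof -
  have \<Gamma>: "\<Gamma> = rook_complement_square 4" and V: "V = pverts (rook_complement_square 4)"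
    using assms by (simp_all add: graph_Gamma_eq)
  have graph: "pair_graph \<Gamma>" unfolding \<Gamma> by (rule pair_graph_rook_complement_square)
  have card: "card V = 256" by (simp add: V pverts_rook_complement_square card_cartesian_product)
  have prim: "primitive_group V (graph_automorphisms \<Gamma>)"
    unfolding V \<Gamma> by (rule primitive_rook_complement_square) simp
  have "(((0, 0), (0, 0)), ((0, 0), (1, 1))) \<in> parcs \<Gamma>"
    unfolding \<Gamma> parcs_rook_complement_square by simp
  then have arcs: "parcs \<Gamma> \<noteq> {}" by blast
  note classes = card_kernel_classes_superposition_map[where n = 4, folded V]
  define f6 where "f6 = superposition_map 4 klein_square switched_square"
  define f9 where "f9 = superposition_map 4 cyclic_square switched_square"
  define f12 where "f12 = superposition_map 4 cyclic_square row_exchanged_square"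
  have endo: "f6 \<in> graph_endomorphisms \<Gamma>" "f9 \<in> graph_endomorphisms \<Gamma>" "f12 \<in> graph_endomorphisms \<Gamma>"
    unfolding \<Gamma> f6_def f9_def f12_def
    by (intro superposition_map_endomorphism latin_squares)+
  have rank: "map_rank V f6 = 6" "map_rank V f9 = 9" "map_rank V f12 = 12"
    unfolding V f6_def f9_def f12_def map_rank_superposition_map
    by (rule superposition_klein_switched superposition_cyclic_switched superposition_cyclic_row_exchanged)+
  have f6: "card (kernel_classes_of_size V f6 32) = 4" "card (kernel_classes_of_size V f6 64) = 2"
    unfolding f6_def
    using classes[of 32 2] classes[of 64 4] superposition_klein_switched by simp_all
  have f9: "card (kernel_classes_of_size V f9 16) = 4" "card (kernel_classes_of_size V f9 32) = 4"
      "card (kernel_classes_of_size V f9 64) = 1"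
    unfolding f9_def
    using classes[of 16 1] classes[of 32 2] classes[of 64 4] superposition_cyclic_switched by simp_all
  have f12: "card (kernel_classes_of_size V f12 16) = 8" "card (kernel_classes_of_size V f12 32) = 4"
    unfolding f12_def
    using classes[of 16 1] classes[of 32 2] superposition_cyclic_row_exchanged by simp_all
  have non_uniform: "non_uniform V f6" "non_uniform V f9" "non_uniform V f12"
    using non_uniformI[of V f6 32 64] non_uniformI[of V f9 16 32] non_uniformI[of V f12 16 32]
      f6 f9 f12 by simp_all
  have "\<not> synchronizes V (graph_automorphisms \<Gamma>) f6"
    using endomorphism_not_synchronized[OF graph arcs endo(1)] assms(2) by simp
  moreover have "f6 \<in> V \<rightarrow>\<^sub>E V"
    using graph_endomorphismsD(1)[OF endo(1)] assms(2) by simp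
  ultimately have "\<exists>f \<in> V \<rightarrow>\<^sub>E V. map_rank V f = 6 \<and> non_uniform V f \<and>
       \<not> synchronizes V (graph_automorphisms \<Gamma>) f"
    using rank non_uniform by blast
  then show ?thesis
    using graph card prim endo rank non_uniform f6 f9 f12 by blast
qed

end
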